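(* Let $\alpha,\beta\in\mathbb{N}_0$, $s\in(0,\infty)$, and let $u_s$ be the $2\pi$-periodic function $$u_s(x)=\sum_{k\in\mathbb{Z}}\frac{k}{\sinh(k\pi/s)}e^{-ikx}.$$ Then, for all $x\in\mathbb{R}$, $$u_s^{(\alpha)}(x)\,u_s^{(\beta)}(x)=\sum_{n=0}^{2+\alpha+\beta}b_{\alpha,\beta}(n)\,u_s^{(n)}(x)+c_{\alpha,\beta},$$ where the coefficients are as follows: $$b_{\alpha,\beta}(2+\alpha+\beta)=-2\frac{(1+\alpha)!\,(1+\beta)!}{(3+\alpha+\beta)!},\qquad b_{\alpha,\beta}(1+\alpha+\beta)=0,$$ and, for $0\le n\leq\alpha+\beta$, $$b_{\alpha,\beta}(n)=(-1)^{1+\frac{\beta-\alpha+n}{2}}\left(\binom{1+\alpha}{1+n}+(-1)^n\binom{1+\beta}{1+n}\right)e_{2+\alpha+\beta-n}+\frac{s}{\pi}\delta_{\alpha,n}\delta_{\beta,0}+\frac{s}{\pi}\delta_{\beta,n}\delta_{\alpha,0},$$ with $$e_\ell=(1+(-1)^\ell)\left(\frac{B_\ell}{\ell}+2\sum_{k=1}^\infty\frac{k^{\ell-1}}{1-e^{2\pi k/s}}\right)\quad(\ell\geq 2),$$ and $$c_{\alpha,\beta}=(-1)^{\frac{\alpha-\beta}{2}}F_{\alpha+\beta}-\frac{s}{\pi}b_{\alpha,\beta}(0),\qquad F_{\alpha+\beta}=\sum_{k\in\mathbb{Z}}\frac{k^{2+\alpha+\beta}}{\sinh^2(k\pi/s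)}.$$
   Context: $\mathbb{N}_0$ is the set of nonnegative integers and $u_s^{(n)}=d^nu_s/dx^n$. In the Fourier series of $u_s$ the $k=0$ coefficient is understood as the limit $s/\pi$; likewise the $k=0$ term of $F_{\alpha+\beta}$ is understood as the limit ($s^2/\pi^2$ if $\alpha+\beta=0$, and $0$ otherwise). $\delta_{i,j}$ is the Kronecker delta, $B_\ell$ is the $\ell$-th Bernoulli number ($B_2=1/6$, $B_4=-1/30$, ...), and $\binom{p}{q}=0$ for integers $q>p\ge 0$. The signs with half-integer exponents occur only multiplied by zero: if $\alpha+\beta+n$ is odd then $e_{2+\alpha+\beta-n}=0$ and $b_{\alpha,\beta}(n)=0$; if $\alpha+\beta$ is odd then $F_{\alpha+\beta}=0$, $b_{\alpha,\beta}(0)=0$ and $c_{\alpha,\beta}=0$. *)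

theory Defs
  imports "HOL-Analysis.Analysis"
begin

text \<open>
  The coefficient $k/\sinh(k\pi/s)$ has a removable singularity at $k = 0$; it is given its limit
  there, since \<open>0 / sinh 0 = 0\<close> in HOL.
\<close>

definition u_coeff :: "real \<Rightarrow> int \<Rightarrow> real" where
  "u_coeff s k = (if k = 0 then s / pi else of_int k / sinh (of_int k * pi / s))"

definition u :: "real \<Rightarrow> real \<Rightarrow> complex" where
  "u s x = (\<Sum>\<^sub>\<infinity>k::int. of_real (u_coeff s k) * exp (- \<i> * of_int k * of_real x))"

definition nth_derivative :: "nat \<Rightarrow> (real \<Rightarrow> complex) \<Rightarrow> real \<Rightarrow> complex" where
  "nth_derivative n f = ((\<lambda>g x. vector_derivative g (at x)) ^^ n) f"

text \<open>The Bernoulli numbers, in the convention $B_1 = -1/2$ (only even indices matter below).\<close>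

fun bernoulli :: "nat \<Rightarrow> real" where
  "bernoulli 0 = 1"
| "bernoulli (Suc n) = - (\<Sum>k\<le>n. real (Suc (Suc n) choose k) * bernoulli k) / real (Suc (Suc n))"

lemma bernoulli_2: "bernoulli 2 = 1 / 6"
  by (simp add: numeral_eq_Suc)

lemma bernoulli_4: "bernoulli 4 = - 1 / 30"
  by (simp add: numeral_eq_Suc)

definition e_coeff :: "real \<Rightarrow> nat \<Rightarrow> real" where
  "e_coeff s l = (1 + (- 1) ^ l) *
     (bernoulli l / real l
      + 2 * (\<Sum>\<^sub>\<infinity>k\<in>{1::nat..}. real k ^ (l - 1) / (1 - exp (2 * pi * real k / s))))"

text \<open>
  \<open>F_sum s m\<close> is $F_m = \sum_k k^{2+m}/\sinh^2(k\pi/s)$, with the limiting value of the summand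
  at $k = 0$.
\<close>

definition F_sum :: "real \<Rightarrow> nat \<Rightarrow> real" where
  "F_sum s m = (\<Sum>\<^sub>\<infinity>k::int.
     if k = 0 then (if m = 0 then s\<^sup>2 / pi\<^sup>2 else 0)
     else of_int k ^ (2 + m) / (sinh (of_int k * pi / s))\<^sup>2)"

text \<open>
  In the two signs below the exponent is a possibly negative integer, hence \<open>powi\<close>. When the number
  divided by 2 is odd, the sign multiplies a zero (\<open>e_coeff\<close> at an odd index, respectively
  \<open>F_sum\<close> at an odd index), so the rounding of \<open>div\<close> is immaterial.
\<close>

definition b_coeff :: "real \<Rightarrow> nat \<Rightarrow> nat \<Rightarrow> nat \<Rightarrow> real" where
  "b_coeff s \<alpha> \<beta> n =
     (if n = 2 + \<alpha> + \<beta> then - 2 * (fact (1 + \<alpha>) * fact (1 + \<beta>) / fact (3 + \<alpha> + \<beta>))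
      else if n = 1 + \<alpha> + \<beta> then 0
      else (- 1) powi (1 + (int \<beta> - int \<alpha> + int n) div 2)
             * (real ((1 + \<alpha>) choose (1 + n)) + (- 1) ^ n * real ((1 + \<beta>) choose (1 + n)))
             * e_coeff s (2 + \<alpha> + \<beta> - n)
           + (s / pi) * of_bool (\<alpha> = n) * of_bool (\<beta> = 0)
           + (s / pi) * of_bool (\<beta> = n) * of_bool (\<alpha> = 0))"

definition c_coeff :: "real \<Rightarrow> nat \<Rightarrow> nat \<Rightarrow> real" where
  "c_coeff s \<alpha> \<beta> =
     (- 1) powi ((int \<alpha> - int \<beta>) div 2) * F_sum s (\<alpha> + \<beta>) - (s / pi) * b_coeff s \<alpha> \<beta> 0"

end

theory Submission
  imports Defs
begin

text \<open>
  Compare Fourier coefficients. With $A = k\pi/s$ and $B = (m-k)\pi/s$ one has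
  $1/(\sinh A \sinh B) = (\coth A + \coth B)/\sinh(A + B)$, so for $m \ne 0$ the coefficient of the
  product at $m$ is $1/\sinh(m\pi/s)$ times the sum over $k$ of
  $k^{1+\alpha}(m-k)^{1+\beta}(\coth A + \coth B)$. Write $\coth(k\pi/s)$ as $\mathrm{sgn}(k)$ plus
  an exponentially small odd remainder. The signs leave the finite sum of $k^{1+\alpha}(m-k)^{1+\beta}$
  over $0 \le k \le m$, a polynomial in $m$ whose coefficients are Bernoulli numbers; the remainders,
  expanded binomially, give the Lambert series in $e_\ell$ with the same binomial factors.
  For $m = 0$ the coefficient is $F_{\alpha+\beta}$ up to sign.
\<close>

subsection \<open>Power sums and Bernoulli numbers\<close>

text \<open>The two cotangents cannot be summed separately: k^(1+\<alpha>) (m-k)^(1+\<beta>) coth(k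
  pi/s) grows with |k|, and only coth A + coth B decays. After the splitting, the signs cancel
  outside [0, m], and each remainder is summable against every polynomial. The signs contribute 2
  zeta(-t) where the remainders contribute their t-th moment, so for odd t the constant e_(t+1) is
  minus the zeta-regularised sum over k of k^t coth(k pi/s). The sum over k must also be divisible
  by m, because the coefficient of \<open>u\<close> at m is m/sinh(m pi/s) and has to be factored
  out; a parity argument removes the constant term. The count over 0 \<le> k \<le> m covers m > 0
  only; a reflection gives m < 0.\<close>

lemma bernoulli_sum: "(\<Sum>k\<le>n. real (Suc n choose k) * bernoulli k) = of_bool (n = 0)"
proof (cases n)
  case (Suc m)
  have "real (Suc (Suc m)) * bernoulli (Suc m)
      = - (\<Sum>k\<le>m. real (Suc (Suc m) choose k) * bernoulli k)"
    by (simp del: of_nat_Suc binomial_Suc_Suc)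
  then show ?thesis
    using Suc by (simp del: bernoulli.simps binomial_Suc_Suc of_nat_Suc)
qed simp

text \<open>The exponential generating function satisfies B(X) (e^X - 1) = X, hence B(-X) = B(X) +
  X; for odd n > 1 the coefficients of X^n give -B_n = B_n.\<close>

lemma bernoulli_odd_eq_0:
  assumes "odd n" "n > 1"
  shows "bernoulli n = 0"
proof -
  define B where "B = Abs_fps (\<lambda>n. bernoulli n / fact n)"
  have 1: "B * (fps_exp 1 - 1) = fps_X"
  proof (rule fps_ext)
    fix n
    show "fps_nth (B * (fps_exp 1 - 1)) n = fps_nth fps_X n"
    proof (cases n)
      case (Suc m)
      have "fps_nth (B * (fps_exp 1 - 1)) n = (\<Sum>i\<le>m. bernoulli i / fact i * (1 / fact (Suc m - i)))"
        unfolding fps_mult_nth Suc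
        by (auto simp: B_def atMost_atLeast0 intro!: sum.cong)
      also have "\<dots> = (\<Sum>i\<le>m. real (Suc m choose i) * bernoulli i) / fact (Suc m)"
        unfolding sum_divide_distrib
        by (rule sum.cong[OF refl], subst binomial_fact) auto
      also have "\<dots> = fps_nth fps_X n"
        unfolding bernoulli_sum using Suc by auto
      finally show ?thesis .
    qed (simp add: B_def)
  qed
  have "(B oo (- fps_X)) * (fps_exp (-1) - 1) = - fps_X"
  proof -
    have "(B * (fps_exp 1 - 1)) oo (- fps_X) = fps_X oo (- fps_X)"
      using 1 by simp
    moreover have "fps_exp 1 oo - fps_X = fps_exp (-1 :: real)"
      by (rule fps_ext) (simp add: fps_compose_uminus')
    ultimately show ?thesis
      by (simp add: fps_compose_mult_distrib fps_compose_sub_distrib)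
  qed
  \<comment> \<open>Multiplying by e^X turns e^(-X) - 1 into 1 - e^X, so that e^X - 1 can be
    cancelled against the equation for B(X).\<close>
  then have "((B oo (- fps_X)) * (fps_exp (-1) - 1)) * fps_exp 1 = - fps_X * fps_exp 1"
    by simp
  moreover have "fps_exp (-1 :: real) * fps_exp 1 = 1"
    by (simp add: fps_exp_add_mult[symmetric])
  ultimately have "(B oo (- fps_X)) * (1 - fps_exp 1) = - fps_X * fps_exp 1"
    by (metis (no_types, lifting) left_diff_distrib mult.assoc mult_1_left)
  then have "(B oo (- fps_X)) * (fps_exp 1 - 1) = fps_X * fps_exp 1"
    by (simp add: algebra_simps)
  also have "\<dots> = (B + fps_X) * (fps_exp 1 - 1)"
    using 1 by (simp add: algebra_simps)
  finally have "B oo (- fps_X) = B + fps_X"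
  proof -
    assume *: "(B oo (- fps_X)) * (fps_exp 1 - 1) = (B + fps_X) * (fps_exp 1 - 1)"
    have "fps_nth (fps_exp (1::real) - 1) 1 \<noteq> 0" by simp
    then have "fps_exp (1::real) - 1 \<noteq> 0" by (metis fps_zero_nth)
    with * show ?thesis by simp
  qed
  then have "fps_nth (B oo (- fps_X)) n = fps_nth (B + fps_X) n" by simp
  then show ?thesis
    using assms by (simp add: fps_compose_uminus' B_def)
qed

text \<open>The value $\zeta(-r)$ for $r > 0$; at $r = 0$ it is $1/2 = -\zeta(0)$.\<close>

definition zneg :: "nat \<Rightarrow> real" where
  "zneg r = - bernoulli (Suc r) / real (Suc r)"

definition bernpoly :: "nat \<Rightarrow> real \<Rightarrow> real" where
  "bernpoly n x = (\<Sum>k\<le>n. real (n choose k) * bernoulli k * x ^ (n - k))"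

text \<open>Expand (x + 1)^(N-k), exchange the sums and use C(N,k) C(N-k,j) = C(N,j) C(N-j,k): the
  inner sum over k is then the Bernoulli recursion.\<close>

lemma bernpoly_diff: "bernpoly (Suc n) (x + 1) - bernpoly (Suc n) x = real (Suc n) * x ^ n"
proof -
  let ?N = "Suc n"
  have "bernpoly ?N (x + 1)
      = (\<Sum>k\<le>?N. \<Sum>j\<le>?N - k. real (?N choose k) * bernoulli k * (real ((?N - k) choose j) * x ^ j))"
    unfolding bernpoly_def binomial_ring by (simp add: sum_distrib_left del: binomial_Suc_Suc bernoulli.simps)
  also have "\<dots> = (\<Sum>j\<le>?N. \<Sum>k\<le>?N - j. real (?N choose k) * bernoulli k * (real ((?N - k) choose j) * x ^ j))"
  proof -
    show ?thesis
      unfolding sum.Sigma[OF finite_atMost ballI[OF finite_atMost]]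
      by (rule sum.reindex_bij_witness[of _ prod.swap prod.swap]) auto
  qed
  also have "\<dots> = (\<Sum>j\<le>?N. real (?N choose j) * x ^ j * (\<Sum>k\<le>?N - j. real ((?N - j) choose k) * bernoulli k))"
  proof (rule sum.cong[OF refl])
    fix j assume "j \<in> {..?N}"
    have "real (?N choose k) * real ((?N - k) choose j) = real (?N choose j) * real ((?N - j) choose k)"
      if "k \<le> ?N - j" for k
    proof -
      have "j + k \<le> ?N" using that \<open>j \<in> {..?N}\<close> by auto
      then show ?thesis
        by (simp add: binomial_fact add.commute del: binomial_Suc_Suc fact_Suc)
    qed
    then show "(\<Sum>k\<le>?N - j. real (?N choose k) * bernoulli k * (real ((?N - k) choose j) * x ^ j))
        = real (?N choose j) * x ^ j * (\<Sum>k\<le>?N - j. real ((?N - j) choose k) * bernoulli k)"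
      unfolding sum_distrib_left
      by (intro sum.cong[OF refl]) (simp add: mult.assoc mult.left_commute del: binomial_Suc_Suc bernoulli.simps)
  qed
  also have "\<dots> = (\<Sum>j\<le>?N. real (?N choose j) * x ^ j * (bernoulli (?N - j) + of_bool (j = n)))"
  proof (rule sum.cong[OF refl])
    fix j assume "j \<in> {..?N}"
    \<comment> \<open>This sum runs one term further than \<open>bernoulli_sum\<close>; that term is
      \<open>bernoulli (?N - j)\<close>. The recursion has the nonzero value 1 only at
      \<open>?N - j = 1\<close>, that is \<open>j = n\<close>.\<close>
    have "(\<Sum>k\<le>?N - j. real ((?N - j) choose k) * bernoulli k) = bernoulli (?N - j) + of_bool (j = n)"
    proof (cases "j = ?N")
      case False
      then obtain i where i: "?N - j = Suc i" and "i = 0 \<longleftrightarrow> j = n"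
        using \<open>j \<in> {..?N}\<close> by (cases "?N - j") (simp_all, linarith)
      then show ?thesis
        unfolding i using bernoulli_sum[of i] by (simp del: binomial_Suc_Suc bernoulli.simps)
    qed simp
    then show "real (?N choose j) * x ^ j * (\<Sum>k\<le>?N - j. real ((?N - j) choose k) * bernoulli k)
      = real (?N choose j) * x ^ j * (bernoulli (?N - j) + of_bool (j = n))" by simp
  qed
  also have "\<dots> = (\<Sum>j\<le>?N. real (?N choose j) * x ^ j * bernoulli (?N - j))
      + (\<Sum>j\<le>?N. real (?N choose j) * x ^ j * of_bool (j = n))"
    by (simp add: distrib_left sum.distrib del: binomial_Suc_Suc bernoulli.simps sum.atMost_Suc)
  also have "(\<Sum>j\<le>?N. real (?N choose j) * x ^ j * of_bool (j = n)) = real ?N * x ^ n"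
    by (simp add: of_bool_def if_distrib cong: if_cong del: binomial_Suc_Suc sum.atMost_Suc)
  also have "(\<Sum>j\<le>?N. real (?N choose j) * x ^ j * bernoulli (?N - j)) = bernpoly ?N x"
    unfolding bernpoly_def
    by (rule sum.reindex_bij_witness[of _ "\<lambda>k. ?N - k" "\<lambda>k. ?N - k"])
       (auto simp: binomial_symmetric[symmetric] simp del: binomial_Suc_Suc bernoulli.simps)
  finally show ?thesis by simp
qed

text \<open>Faulhaber's formula by telescoping a Bernoulli polynomial, with the coefficients
  rewritten through C(p+1,i+1) = (p+1) C(p,i)/(i+1) so that values of \<open>zneg\<close>
  appear.\<close>

lemma sum_of_powers:
  "(\<Sum>k\<le>m. real k ^ p) = real m ^ Suc p / real (Suc p) + zneg p
     + (\<Sum>j\<le>p. (-1) ^ (p + j) * real (p choose j) * zneg (p - j) * real m ^ j)"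
proof -
  \<comment> \<open>By reflection this is the Bernoulli polynomial of degree p + 1 at x + 1. The
    shift makes the telescoping sum include the endpoint k = m; in the coefficients it flips the
    sign of B_1.\<close>
  define A where "A x = (-1) ^ Suc p * bernpoly (Suc p) (- x)" for x
  have A_diff: "A (x + 1) - A x = real (Suc p) * (x + 1) ^ p" for x
  proof -
    have "A (x + 1) - A x = (-1) ^ Suc p * - (bernpoly (Suc p) ((- x - 1) + 1) - bernpoly (Suc p) (- x - 1))"
      by (simp add: A_def right_diff_distrib minus_diff_commute)
    also have "\<dots> = (-1) ^ p * (real (Suc p) * (- (x + 1)) ^ p)"
      unfolding bernpoly_diff by simp
    also have "\<dots> = real (Suc p) * (((-1) * - (x + 1)) ^ p)"
      unfolding power_mult_distrib by (simp del: mult_minus_left)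
    finally show ?thesis by (simp add: add.commute)
  qed
  have sum: "real (Suc p) * (\<Sum>k\<le>m. real k ^ p) = A (real m) - bernoulli (Suc p)"
  proof (induction m)
    case 0
    have "bernpoly (Suc p) 0 = (\<Sum>k\<le>Suc p. if k = Suc p then bernoulli (Suc p) else 0)"
      unfolding bernpoly_def by (rule sum.cong) (auto simp del: binomial_Suc_Suc bernoulli.simps)
    then have "bernpoly (Suc p) 0 = bernoulli (Suc p)" by (simp del: bernoulli.simps)
    \<comment> \<open>For p = 0 the left side is \<open>0 ^ 0 = 1\<close> and the right side is -2
      B_1. For p > 0 both vanish, either by sign or because B_(p+1) = 0.\<close>
    then show ?case
      using bernoulli_odd_eq_0[of "Suc p"]
      by (cases "p = 0"; cases "even p") (auto simp: A_def simp del: bernoulli.simps, auto)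
  next
    case (Suc m)
    then show ?case using A_diff[of "real m"] by (simp add: algebra_simps del: bernoulli.simps)
  qed
  have "A (real m) = (\<Sum>k\<le>Suc p. real (Suc p choose k) * ((-1) ^ k * bernoulli k) * real m ^ (Suc p - k))"
    unfolding A_def bernpoly_def sum_distrib_left
  proof (rule sum.cong[OF refl])
    fix k assume "k \<in> {..Suc p}"
    then have "(-1) ^ Suc p * (- real m) ^ (Suc p - k) = (-1) ^ k * real m ^ (Suc p - k)"
      by (subst power_minus) (auto simp: minus_one_power_iff)
    then show "(-1) ^ Suc p * (real (Suc p choose k) * bernoulli k * (- real m) ^ (Suc p - k))
      = real (Suc p choose k) * ((-1) ^ k * bernoulli k) * real m ^ (Suc p - k)"
      by (metis (no_types, opaque_lifting) mult.assoc mult.left_commute)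
  qed
  also have "\<dots> = real m ^ Suc p
      + (\<Sum>i\<le>p. real (Suc p choose Suc i) * ((-1) ^ Suc i * bernoulli (Suc i)) * real m ^ (p - i))"
    by (subst sum.atMost_Suc_shift) (simp del: binomial_Suc_Suc bernoulli.simps(2))
  also have "(\<Sum>i\<le>p. real (Suc p choose Suc i) * ((-1) ^ Suc i * bernoulli (Suc i)) * real m ^ (p - i))
      = (\<Sum>i\<le>p. real (Suc p) * ((-1) ^ i * real (p choose i) * zneg i * real m ^ (p - i)))"
  proof (rule sum.cong[OF refl])
    fix i
    have "real (Suc i) * real (Suc p choose Suc i) = real (Suc p) * real (p choose i)"
      using Suc_times_binomial_eq[of p i] by (metis mult.commute of_nat_mult)
    then have "real (Suc p choose Suc i) = real (Suc p) * real (p choose i) / real (Suc i)"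
      by (simp add: field_simps del: binomial_Suc_Suc)
    then show "real (Suc p choose Suc i) * ((-1) ^ Suc i * bernoulli (Suc i)) * real m ^ (p - i)
      = real (Suc p) * ((-1) ^ i * real (p choose i) * zneg i * real m ^ (p - i))"
      unfolding zneg_def by (simp del: binomial_Suc_Suc bernoulli.simps)
  qed
  also have "\<dots> = real (Suc p) * (\<Sum>i\<le>p. (-1) ^ i * real (p choose i) * zneg i * real m ^ (p - i))"
    by (simp add: sum_distrib_left)
  also have "(\<Sum>i\<le>p. (-1) ^ i * real (p choose i) * zneg i * real m ^ (p - i))
     = (\<Sum>j\<le>p. (-1) ^ (p + j) * real (p choose j) * zneg (p - j) * real m ^ j)"
    by (rule sum.reindex_bij_witness[of _ "\<lambda>k. p - k" "\<lambda>k. p - k"])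
       (auto simp: binomial_symmetric[symmetric] minus_one_power_iff)
  finally have "real (Suc p) * (\<Sum>k\<le>m. real k ^ p) = real m ^ Suc p
      + real (Suc p) * (\<Sum>j\<le>p. (-1) ^ (p + j) * real (p choose j) * zneg (p - j) * real m ^ j)
      + real (Suc p) * zneg p"
    using sum by (simp add: zneg_def del: bernoulli.simps of_nat_Suc)
  then have "real (Suc p) * (\<Sum>k\<le>m. real k ^ p) = real (Suc p) * (real m ^ Suc p / real (Suc p) + zneg p
     + (\<Sum>j\<le>p. (-1) ^ (p + j) * real (p choose j) * zneg (p - j) * real m ^ j))"
    by (simp add: distrib_left del: of_nat_Suc)
  then show ?thesis
    unfolding mult_cancel_left by simp
qed

lemma sum_power_shift:
  fixes x :: real
  shows "x * (\<Sum>j\<le>n. f j * x ^ j) = (\<Sum>j\<le>Suc n. (if j = 0 then 0 else f (j - 1)) * x ^ j)"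
  by (subst sum.atMost_Suc_shift) (simp add: sum_distrib_left mult_ac)

text \<open>
  Exact Euler--Maclaurin formula for $x^p (m - x)^q$. Both sides satisfy the recursion
  $T(p, q + 1) = m\,T(p, q) - T(p + 1, q)$, which reduces it to sums of powers; \<open>0 ^ 0 = 1\<close> counts.
\<close>

lemma sum_of_power_products:
  "(\<Sum>k\<le>m. real k ^ p * real (m - k) ^ q)
     = fact p * fact q / fact (p + q + 1) * real m ^ (p + q + 1)
       + (\<Sum>j\<le>p + q. ((-1) ^ (q + j) * real (q choose j) + (-1) ^ (p + j) * real (p choose j))
                       * zneg (p + q - j) * real m ^ j)"
proof (induction q arbitrary: p)
  case 0
  \<comment> \<open>Only j = 0 survives in \<open>0 choose j\<close>; it accounts for the separate
    constant \<open>zneg p\<close> in \<open>sum_of_powers\<close>.\<close>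
  have "(\<Sum>j\<le>p. (-1) ^ j * real (0 choose j) * zneg (p - j) * real m ^ j) = zneg p"
    by (subst sum.remove[of _ 0]) (auto intro!: sum.neutral)
  moreover have "fact p / fact (Suc p) = 1 / real (Suc p)"
    by simp
  ultimately show ?case
    by (simp add: sum_of_powers distrib_right sum.distrib del: fact_Suc of_nat_Suc)
next
  case (Suc q)
  let ?c = "\<lambda>p q j. (-1) ^ (q + j) * real (q choose j) + (-1) ^ (p + j) * real (p choose j)"
  have "(\<Sum>k\<le>m. real k ^ p * real (m - k) ^ Suc q)
      = real m * (\<Sum>k\<le>m. real k ^ p * real (m - k) ^ q) - (\<Sum>k\<le>m. real k ^ Suc p * real (m - k) ^ q)"
    unfolding sum_distrib_left sum_subtractf[symmetric]
    by (rule sum.cong) (auto simp: of_nat_diff algebra_simps)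
  also have "\<dots> = (fact p * fact q / fact (p + q + 1) - fact (Suc p) * fact q / fact (p + q + 2)) * real m ^ (p + q + 2)
      + (real m * (\<Sum>j\<le>p + q. ?c p q j * zneg (p + q - j) * real m ^ j)
         - (\<Sum>j\<le>Suc (p + q). ?c (Suc p) q j * zneg (Suc (p + q) - j) * real m ^ j))"
    unfolding Suc.IH by (simp add: algebra_simps)
  also have "fact p * fact q / fact (p + q + 1) - fact (Suc p) * fact q / fact (p + q + 2)
      = fact p * fact (Suc q) / (fact (p + q + 2) :: real)"
  proof -
    have "fact (p + q + 2) = (real p + real q + 2) * fact (p + q + 1)"
      by (simp add: algebra_simps)
    then show ?thesis
      by (simp add: divide_simps del: fact_Suc add: fact_Suc[of p] fact_Suc[of q]) (simp add: algebra_simps)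
  qed
  \<comment> \<open>After the index shift both sums carry the same \<open>zneg\<close> values, and
    Pascal's rule in q and in p combines the coefficients.\<close>
  also have "real m * (\<Sum>j\<le>p + q. ?c p q j * zneg (p + q - j) * real m ^ j)
         - (\<Sum>j\<le>Suc (p + q). ?c (Suc p) q j * zneg (Suc (p + q) - j) * real m ^ j)
      = (\<Sum>j\<le>Suc (p + q). ?c p (Suc q) j * zneg (Suc (p + q) - j) * real m ^ j)"
    unfolding sum_power_shift sum_subtractf[symmetric]
  proof (rule sum.cong[OF refl])
    fix j assume "j \<in> {..Suc (p + q)}"
    show "(if j = 0 then 0 else ?c p q (j - 1) * zneg (p + q - (j - 1))) * real m ^ j
         - ?c (Suc p) q j * zneg (Suc (p + q) - j) * real m ^ j
       = ?c p (Suc q) j * zneg (Suc (p + q) - j) * real m ^ j"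
      by (cases j) (simp_all add: algebra_simps)
  qed
  finally show ?case by simp
qed

subsection \<open>Fourier series\<close>

lemma summable_on_UNIV_intI:
  fixes f :: "int \<Rightarrow> real"
  assumes "summable (\<lambda>n. \<bar>f (int n)\<bar>)" "summable (\<lambda>n. \<bar>f (- int n)\<bar>)"
  shows "f summable_on UNIV"
proof -
  have "f summable_on range int"
    by (subst summable_on_reindex) (auto simp: o_def intro!: norm_summable_imp_summable_on assms)
  moreover have "f summable_on range (\<lambda>n. - int n)"
    by (subst summable_on_reindex) (auto simp: inj_def o_def intro!: norm_summable_imp_summable_on assms)
  ultimately have "f summable_on (range int \<union> range (\<lambda>n. - int n))"
    by (rule summable_on_union)
  moreover have "range int \<union> range (\<lambda>n. - int n) = UNIV"
    by (auto intro: int_cases2)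
  ultimately show ?thesis by simp
qed

text \<open>A single term of the exponential series, the one of index N + 2, bounds exp(c n) from
  below and leaves a multiple of 1/n^2.\<close>

lemma summable_power_times_exp:
  fixes c :: real
  assumes "c > 0"
  shows "summable (\<lambda>n. real n ^ N * exp (- c * real n))"
proof (rule summable_comparison_test')
  show "summable (\<lambda>n. (fact (N + 2) / c ^ (N + 2)) * (1 / real n ^ 2))"
    by (intro summable_mult inverse_power_summable[where 'a = real, unfolded inverse_eq_divide]) simp
  show "norm (real n ^ N * exp (- c * real n)) \<le> (fact (N + 2) / c ^ (N + 2)) * (1 / real n ^ 2)"
    if "n \<ge> 1" for n
  proof -
    have "(c * real n) ^ (N + 2) / fact (N + 2) \<le> exp (c * real n)"
    proof -
      have "(\<Sum>k\<in>{N + 2}. (c * real n) ^ k /\<^sub>R fact k) \<le> exp (c * real n)"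
        unfolding exp_def using assms
        by (intro sum_le_suminf summable_exp_generic) (auto simp: zero_le_mult_iff)
      then show ?thesis by (simp add: divide_inverse mult.commute)
    qed
    then have "real n ^ N * (c ^ (N + 2) * real n ^ 2) \<le> fact (N + 2) * exp (c * real n)"
      by (simp add: divide_le_eq power_mult_distrib power_add power2_eq_square mult_ac del: fact_Suc)
    then have "real n ^ N / exp (c * real n) \<le> fact (N + 2) / (c ^ (N + 2) * real n ^ 2)"
      using that assms by (intro mult_imp_div_pos_le) (auto simp: field_simps simp del: fact_Suc)
    then show ?thesis
      by (simp add: exp_minus inverse_eq_divide del: fact_Suc)
  qed
qed

lemma has_sum_sum:
  fixes f :: "'a \<Rightarrow> 'b \<Rightarrow> 'c :: topological_comm_monoid_add"
  assumes "finite J" "\<And>j. j \<in> J \<Longrightarrow> ((\<lambda>k. f j k) has_sum S j) A"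
  shows "((\<lambda>k. \<Sum>j\<in>J. f j k) has_sum (\<Sum>j\<in>J. S j)) A"
  using assms by (induction J rule: finite_induct) (auto intro: has_sum_add)

text \<open>Unconditional: if \<open>f\<close> is not summable, neither is its complex version, and
  both sums take the default value 0.\<close>

lemma infsum_of_real_complex: "(\<Sum>\<^sub>\<infinity>k\<in>A. complex_of_real (f k)) = of_real (infsum f A)"
proof (cases "f summable_on A")
  case False
  then have "\<not> (\<lambda>k. complex_of_real (f k)) summable_on A"
    using summable_on_Re by force
  with False show ?thesis by (simp add: infsum_not_exists)
qed (auto intro!: infsumI has_sum_of_real)

text \<open>The sums over integers become series along \<open>int_decode\<close>. Every exponential
  has norm 1, so the norms of \<open>of_int k * c k\<close> dominate the differentiated series
  uniformly in x, and the Weierstrass M-test permits termwise differentiation.\<close>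

lemma has_vector_derivative_fourier_series:
  fixes c :: "int \<Rightarrow> complex"
  assumes c: "(\<lambda>k. norm (c k)) summable_on UNIV"
    and kc: "(\<lambda>k. norm (of_int k * c k)) summable_on UNIV"
  shows "((\<lambda>x. \<Sum>\<^sub>\<infinity>k. c k * exp (- \<i> * of_int k * of_real x)) has_vector_derivative
          (\<Sum>\<^sub>\<infinity>k. (- \<i> * of_int k) * c k * exp (- \<i> * of_int k * of_real x))) (at x)"
proof -
  define E where "E k x = exp (- \<i> * of_int k * of_real x)" for k :: int and x :: real
  have norm_E: "norm (E k x) = 1" for k x
    by (simp add: E_def norm_exp_eq_Re)
  have sums: "(\<lambda>n. f (int_decode n) * E (int_decode n) x) sums (\<Sum>\<^sub>\<infinity>k. f k * E k x)"
    if "(\<lambda>k. norm (f k)) summable_on UNIV" for f x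
  proof -
    have "(\<lambda>k. f k * E k x) summable_on UNIV"
      by (rule abs_summable_summable) (use that in \<open>simp add: norm_mult norm_E\<close>)
    then have "((\<lambda>n. f (int_decode n) * E (int_decode n) x) has_sum (\<Sum>\<^sub>\<infinity>k. f k * E k x)) UNIV"
      by (subst has_sum_reindex_bij_betw[OF bij_int_decode]) simp
    then show ?thesis by (rule has_sum_imp_sums)
  qed
  define d where "d k = - \<i> * of_int k * c k" for k :: int
  have d: "(\<lambda>k. norm (d k)) summable_on UNIV"
    using kc by (simp add: d_def norm_mult)
  have "(\<lambda>n. norm (d (int_decode n))) summable_on UNIV"
    using d by (subst summable_on_reindex_bij_betw[OF bij_int_decode])
  then have summable_d: "summable (\<lambda>n. norm (d (int_decode n)))"
    by (rule summable_on_imp_summable)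
  define g' where "g' x = (\<Sum>\<^sub>\<infinity>k. d k * E k x)" for x
  have unif: "uniform_limit UNIV (\<lambda>n x. \<Sum>i<n. d (int_decode i) * E (int_decode i) x)
      (\<lambda>x. \<Sum>i. d (int_decode i) * E (int_decode i) x) sequentially"
    by (rule Weierstrass_m_test[OF _ summable_d]) (simp add: norm_mult norm_E)
  then have unif: "uniform_limit UNIV (\<lambda>n x. \<Sum>i<n. d (int_decode i) * E (int_decode i) x) g' sequentially"
    using sums[OF d] by (simp add: sums_iff g'_def[abs_def])
  have "\<exists>g. \<forall>x\<in>UNIV. (\<lambda>n. c (int_decode n) * E (int_decode n) x) sums g x
      \<and> (g has_derivative (\<lambda>h. h *\<^sub>R g' x)) (at x within UNIV)"
  proof (rule has_derivative_series)
    show "((\<lambda>x. c (int_decode n) * E (int_decode n) x) has_derivative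
       (\<lambda>h. h *\<^sub>R (d (int_decode n) * E (int_decode n) x))) (at x within UNIV)" for n x
      unfolding has_vector_derivative_def[symmetric] E_def d_def
      by (rule has_vector_derivative_real_field derivative_eq_intros refl | simp)+
    show "\<forall>\<^sub>F n in sequentially. \<forall>x\<in>UNIV. \<forall>h. norm ((\<Sum>i<n. h *\<^sub>R (d (int_decode i) * E (int_decode i) x))
        - h *\<^sub>R g' x) \<le> e * norm h" if "e > 0" for e
      using uniform_limitD[OF unif that]
    proof eventually_elim
      case (elim n)
      have "norm ((\<Sum>i<n. h *\<^sub>R (d (int_decode i) * E (int_decode i) x)) - h *\<^sub>R g' x)
        = \<bar>h\<bar> * dist (\<Sum>i<n. d (int_decode i) * E (int_decode i) x) (g' x)" for h x
        by (simp add: scaleR_sum_right[symmetric] scaleR_diff_right[symmetric] dist_norm)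
      moreover have "\<bar>h\<bar> * dist (\<Sum>i<n. d (int_decode i) * E (int_decode i) x) (g' x) \<le> \<bar>h\<bar> * e" for h x
        using elim by (intro mult_left_mono) (auto intro: less_imp_le)
      ultimately show ?case
        by (simp add: mult.commute)
    qed
  qed (use sums[OF c] in auto)
  then obtain g where g: "\<And>x. (\<lambda>n. c (int_decode n) * E (int_decode n) x) sums g x"
    "\<And>x. (g has_vector_derivative g' x) (at x)"
    by (auto simp: has_vector_derivative_def)
  have "g = (\<lambda>x. \<Sum>\<^sub>\<infinity>k. c k * E k x)"
    using g(1) sums[OF c] by (auto simp: sums_iff)
  with g(2) show ?thesis
    by (simp add: g'_def E_def d_def)
qed

text \<open>The family f(k) g(l) is absolutely summable over all pairs, so it may be regrouped along
  the lines k + l = m.\<close>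

lemma infsum_mult_convolution:
  fixes f g :: "int \<Rightarrow> complex"
  assumes f: "(\<lambda>k. norm (f k)) summable_on UNIV" and g: "(\<lambda>k. norm (g k)) summable_on UNIV"
  shows "(\<Sum>\<^sub>\<infinity>k. f k) * (\<Sum>\<^sub>\<infinity>k. g k) = (\<Sum>\<^sub>\<infinity>m. \<Sum>\<^sub>\<infinity>k. f k * g (m - k))"
proof -
  have "(\<lambda>kl. norm (case kl of (k, l) \<Rightarrow> f k * g l)) summable_on (UNIV \<times> UNIV)"
    by (subst Infinite_Sum.abs_summable_on_Sigma_iff)
       (use f g in \<open>simp add: norm_mult infsum_cmult_right' abs_mult summable_on_cmult_left summable_on_cmult_right infsum_nonneg\<close>)
  then have "(\<lambda>(k, l). f k * g l) summable_on (UNIV \<times> UNIV)"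
    by (rule abs_summable_summable)
  then have fg: "(\<lambda>(k, l). f k * g l) summable_on UNIV"
    by simp
  have bij: "bij_betw (\<lambda>(m, k). (k, m - k)) (UNIV :: (int \<times> int) set) UNIV"
    by (rule bij_betw_byWitness[where f' = "\<lambda>(k, l). (k + l, k)"]) auto
  have conv: "(\<lambda>(m, k). f k * g (m - k)) summable_on (UNIV \<times> UNIV)"
    using fg summable_on_reindex_bij_betw[OF bij, of "\<lambda>(k, l). f k * g l"]
    by (simp add: case_prod_unfold)
  have "(\<Sum>\<^sub>\<infinity>k. f k) * (\<Sum>\<^sub>\<infinity>k. g k) = (\<Sum>\<^sub>\<infinity>k. \<Sum>\<^sub>\<infinity>l. f k * g l)"
    by (simp add: infsum_cmult_right' infsum_cmult_left')
  also have "\<dots> = (\<Sum>\<^sub>\<infinity>(k, l). f k * g l)"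
    using fg by (subst infsum_Sigma'_banach) auto
  also have "\<dots> = (\<Sum>\<^sub>\<infinity>(m, k). f k * g (m - k))"
    using infsum_reindex_bij_betw[OF bij, of "\<lambda>(k, l). f k * g l"]
    by (simp add: case_prod_unfold)
  also have "\<dots> = (\<Sum>\<^sub>\<infinity>m. \<Sum>\<^sub>\<infinity>k. f k * g (m - k))"
    using conv by (subst infsum_Sigma'_banach) auto
  finally show ?thesis .
qed

section \<open>Decay of the coefficients and the derivatives of \<open>u\<close>\<close>

lemma u_coeff_minus [simp]: "u_coeff s (- k) = u_coeff s k"
  by (simp add: u_coeff_def)

lemma summable_u_coeff:
  assumes "s > 0"
  shows "(\<lambda>k. of_int k ^ N * u_coeff s k) summable_on UNIV"
proof -
  define c where "c = pi / s"
  have c: "c > 0" using assms by (simp add: c_def)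
  \<comment> \<open>From 2 sinh t = e^t (1 - e^(-2t)). For n \<ge> 1 the argument n pi/s is at least
    c, so one constant serves all n.\<close>
  have sinh_ge: "exp t * ((1 - exp (-2 * c)) / 2) \<le> sinh t" if "t \<ge> c" for t
  proof -
    have "exp t * (1 - exp (- 2 * t)) = 2 * sinh t"
      by (simp add: sinh_def algebra_simps exp_add[symmetric])
    moreover have "exp t * (1 - exp (- 2 * c)) \<le> exp t * (1 - exp (- 2 * t))"
      using that by (intro mult_left_mono) auto
    ultimately show ?thesis by simp
  qed
  have pos: "0 < 1 - exp (- 2 * c)" using c by simp
  have bound: "norm (real n ^ N * u_coeff s (int n))
      \<le> 2 / (1 - exp (- 2 * c)) * (real n ^ Suc N * exp (- c * real n))" if "n \<ge> 1" for n
  proof -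
    have "exp (c * real n) * ((1 - exp (-2 * c)) / 2) \<le> sinh (c * real n)"
      using that c by (intro sinh_ge) simp
    moreover have "0 < exp (c * real n) * ((1 - exp (-2 * c)) / 2)"
      using pos by simp
    ultimately have "real n ^ Suc N / sinh (c * real n)
        \<le> real n ^ Suc N / (exp (c * real n) * ((1 - exp (-2 * c)) / 2))"
      by (intro divide_left_mono mult_pos_pos) (use c that in auto)
    also have "\<dots> = 2 / (1 - exp (- 2 * c)) * (real n ^ Suc N * exp (- c * real n))"
      using pos by (simp add: exp_minus field_simps)
    finally show ?thesis
      using that c assms by (simp add: u_coeff_def abs_mult power_abs) (simp add: c_def mult.commute)
  qed
  have "summable (\<lambda>n. \<bar>real n ^ N * u_coeff s (int n)\<bar>)"
  proof (rule summable_comparison_test'[of _ 1])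
    show "summable (\<lambda>n. 2 / (1 - exp (- 2 * c)) * (real n ^ Suc N * exp (- c * real n)))"
      by (intro summable_mult summable_power_times_exp c)
  qed (use bound in simp)
  then show ?thesis
    by (intro summable_on_UNIV_intI) (simp_all add: abs_mult power_abs)
qed

lemma summable_norm_u_coeff:
  assumes "s > 0"
  shows "(\<lambda>k. norm ((- \<i> * of_int k) ^ N * of_real (u_coeff s k))) summable_on UNIV"
proof -
  have "(\<lambda>k. norm (of_int k ^ N * u_coeff s k)) summable_on UNIV"
    using summable_u_coeff[OF assms] by (rule summable_on_iff_abs_summable_on_real[THEN iffD1])
  then show ?thesis by (simp add: norm_mult norm_power abs_mult power_abs)
qed

lemma nth_derivative_u:
  assumes "s > 0"
  shows "nth_derivative n (u s) x
    = (\<Sum>\<^sub>\<infinity>k. (- \<i> * of_int k) ^ n * of_real (u_coeff s k) * exp (- \<i> * of_int k * of_real x))"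
proof (induction n arbitrary: x)
  case 0
  show ?case by (simp add: nth_derivative_def u_def)
next
  case (Suc n)
  have "(nth_derivative n (u s) has_vector_derivative
     (\<Sum>\<^sub>\<infinity>k. (- \<i> * of_int k) * ((- \<i> * of_int k) ^ n * of_real (u_coeff s k)) * exp (- \<i> * of_int k * of_real x))) (at x)"
    unfolding Suc.IH[abs_def]
  proof (rule has_vector_derivative_fourier_series)
    show "(\<lambda>k. norm ((- \<i> * of_int k) ^ n * of_real (u_coeff s k))) summable_on UNIV"
      by (rule summable_norm_u_coeff[OF assms])
    show "(\<lambda>k. norm (of_int k * ((- \<i> * of_int k) ^ n * of_real (u_coeff s k)))) summable_on UNIV"
      using summable_norm_u_coeff[OF assms, of "Suc n"] by (simp add: norm_mult mult_ac)
  qed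
  then show ?case
    by (simp add: nth_derivative_def vector_derivative_at mult_ac)
qed

subsection \<open>Splitting the hyperbolic cotangent\<close>

text \<open>The part of $\coth(k\pi/s)$ that decays exponentially in $|k|$.\<close>

definition coth_remainder :: "real \<Rightarrow> int \<Rightarrow> real" where
  "coth_remainder s k = of_int (sgn k) * (2 / (exp (2 * pi * of_int \<bar>k\<bar> / s) - 1))"

lemma cosh_div_sinh_eq:
  fixes t :: real
  assumes "t \<noteq> 0"
  shows "cosh t / sinh t = 1 + 2 / (exp (2 * t) - 1)"
proof -
  have "exp (2 * t) = exp t * exp t" by (simp add: exp_double power2_eq_square)
  moreover have "exp t * exp t \<noteq> 1"
    using assms by (simp flip: exp_add)
  ultimately show ?thesis
    by (simp add: cosh_def sinh_def exp_minus) (simp add: field_simps)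
qed

lemma coth_eq_sgn_plus_remainder:
  assumes "s > 0" "k \<noteq> 0"
  shows "cosh (of_int k * pi / s) / sinh (of_int k * pi / s) = of_int (sgn k) + coth_remainder s k"
proof (cases "k > 0")
  case True
  then show ?thesis
    using cosh_div_sinh_eq[of "of_int k * pi / s"] assms
    by (simp add: coth_remainder_def mult_ac)
next
  case False
  then show ?thesis
    using cosh_div_sinh_eq[of "- (of_int k * pi / s)"] assms
    by (simp add: coth_remainder_def mult_ac)
qed

lemma coth_remainder_0 [simp]: "coth_remainder s 0 = 0"
  by (simp add: coth_remainder_def)

lemma coth_remainder_minus [simp]: "coth_remainder s (- k) = - coth_remainder s k"
  by (simp add: coth_remainder_def)

text \<open>For k > 0 and t = k pi/s the remainder is e^(-t)/sinh t, and e^(-t) \<le> 1 \<le> k. The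
  summability of \<open>u_coeff\<close> against powers thus carries over to the remainder.\<close>

lemma abs_coth_remainder_le:
  assumes "s > 0"
  shows "\<bar>coth_remainder s k\<bar> \<le> \<bar>u_coeff s k\<bar>"
proof -
  have *: "\<bar>coth_remainder s k\<bar> \<le> \<bar>u_coeff s k\<bar>" if "k > 0" for k
  proof -
    define t where "t = of_int k * pi / s"
    have t: "t > 0" using assms that by (simp add: t_def)
    have "2 / (exp (2 * t) - 1) = exp (- t) / sinh t"
    proof -
      have "exp (2 * t) = exp t * exp t" by (simp add: exp_double power2_eq_square)
      moreover have "exp t * exp t \<noteq> 1"
        using t by (simp flip: exp_add)
      ultimately show ?thesis
        by (simp add: sinh_def exp_minus) (simp add: field_simps)
    qed
    also have "\<dots> \<le> of_int k / sinh t"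
    proof (rule divide_right_mono)
      have "exp (- t) \<le> 1" using t by simp
      also have "1 \<le> real_of_int k" using that by simp
      finally show "exp (- t) \<le> of_int k" .
    qed (use t in simp)
    finally have "2 / (exp (2 * t) - 1) \<le> of_int k / sinh t" .
    moreover have "coth_remainder s k = 2 / (exp (2 * t) - 1)" "u_coeff s k = of_int k / sinh t"
      using that by (simp_all add: coth_remainder_def u_coeff_def t_def mult_ac)
    moreover have "0 \<le> 2 / (exp (2 * t) - 1)" "0 \<le> of_int k / sinh t"
      using that t by simp_all
    ultimately show ?thesis by (simp only: abs_of_nonneg)
  qed
  consider "k > 0" | "k = 0" | "- k > 0" by linarith
  then show ?thesis
    using *[of k] *[of "- k"] by cases auto
qed

lemma summable_coth_remainder:
  assumes "s > 0"
  shows "(\<lambda>k. of_int k ^ t * coth_remainder s k) summable_on UNIV"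
proof -
  have "(\<lambda>k. \<bar>of_int k ^ t * u_coeff s k\<bar>) summable_on UNIV"
    using summable_u_coeff[OF assms, of t]
      summable_on_iff_abs_summable_on_real[of "\<lambda>k. of_int k ^ t * u_coeff s k"] by simp
  then have "(\<lambda>k. \<bar>of_int k ^ t * coth_remainder s k\<bar>) summable_on UNIV"
    by (rule summable_on_comparison_test)
       (auto simp: abs_mult intro!: mult_left_mono abs_coth_remainder_le assms)
  then show ?thesis
    using summable_on_iff_abs_summable_on_real[of "\<lambda>k. of_int k ^ t * coth_remainder s k"] by simp
qed

section \<open>Moments of the remainder and the constants e_l\<close>

definition remainder_moment :: "real \<Rightarrow> nat \<Rightarrow> real" where
  "remainder_moment s t = (\<Sum>\<^sub>\<infinity>k. of_int k ^ t * coth_remainder s k)"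

text \<open>The remainder is odd in k, so the negative half is -(-1)^t times the positive half: even
  moments vanish, odd ones double the Lambert series.\<close>

lemma remainder_moment_eq:
  assumes "s > 0"
  shows "remainder_moment s t
    = - (1 - (-1) ^ t) * 2 * (\<Sum>\<^sub>\<infinity>k\<in>{1::nat..}. real k ^ t / (1 - exp (2 * pi * real k / s)))"
proof -
  let ?h = "\<lambda>k. of_int k ^ t * coth_remainder s k"
  let ?S = "\<Sum>\<^sub>\<infinity>k\<in>{1::nat..}. real k ^ t / (1 - exp (2 * pi * real k / s))"
  have summ: "?h summable_on A" for A
    using summable_coth_remainder[OF assms] summable_on_subset by blast
  have "remainder_moment s t = infsum ?h ({0<..} \<union> {..<0})"
    unfolding remainder_moment_def by (rule infsum_cong_neutral) (auto simp: not_less)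
  also have "\<dots> = infsum ?h {0<..} + infsum ?h {..<0}"
    by (rule infsum_Un_disjoint[OF summ summ]) auto
  also have "infsum ?h {..<0} = (\<Sum>\<^sub>\<infinity>k\<in>{0<..}. (- ((-1) ^ t)) * ?h k)"
    by (rule infsum_reindex_bij_witness[of _ uminus uminus])
       (auto simp: minus_one_power_iff)
  also have "\<dots> = (- ((-1) ^ t)) * infsum ?h {0<..}"
    by (rule infsum_cmult_right')
  also have "infsum ?h {0<..} = (\<Sum>\<^sub>\<infinity>k\<in>{1::nat..}. -2 * (real k ^ t / (1 - exp (2 * pi * real k / s))))"
  proof (rule infsum_reindex_bij_witness[of _ int nat])
    fix k :: int assume "k \<in> {0<..}"
    then have "k > 0" and "exp (2 * (pi * real_of_int k) / s) \<noteq> 1" using assms by auto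
    then show "- 2 * (real (nat k) ^ t / (1 - exp (2 * pi * real (nat k) / s))) = ?h k"
      by (simp add: coth_remainder_def divide_simps) (simp add: algebra_simps)
  qed auto
  also have "\<dots> = -2 * ?S"
    by (rule infsum_cmult_right')
  finally show ?thesis by (simp add: algebra_simps)
qed

text \<open>Both sides vanish for even t, since B_(t+1) = 0 there. At t = 0 the identity fails: e_1
  = 0, but \<open>zneg 0\<close> is 1/2.\<close>

lemma e_coeff_Suc:
  assumes "s > 0" "t \<ge> 1"
  shows "e_coeff s (Suc t) = - (2 * zneg t + remainder_moment s t)"
proof (cases "even t")
  case True
  then have "bernoulli (Suc t) = 0" using assms by (intro bernoulli_odd_eq_0) auto
  with True show ?thesis
    by (simp add: e_coeff_def remainder_moment_eq[OF assms(1)] zneg_def del: bernoulli.simps)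
next
  case False
  then show ?thesis
    by (simp add: e_coeff_def remainder_moment_eq[OF assms(1)] zneg_def del: bernoulli.simps)
qed

lemma has_sum_binomial_coth_remainder:
  fixes m :: real
  assumes "s > 0"
  shows "((\<lambda>k. of_int k ^ p * (m + \<sigma> * of_int k) ^ q * coth_remainder s k) has_sum
    (\<Sum>j\<le>p + q. \<sigma> ^ (q - j) * real (q choose j) * remainder_moment s (p + q - j) * m ^ j)) UNIV"
proof -
  have "((\<lambda>k. \<Sum>j\<le>q. (\<sigma> ^ (q - j) * real (q choose j) * m ^ j) * (of_int k ^ (p + q - j) * coth_remainder s k)) has_sum
    (\<Sum>j\<le>q. (\<sigma> ^ (q - j) * real (q choose j) * m ^ j) * remainder_moment s (p + q - j))) UNIV"
    unfolding remainder_moment_def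
    by (intro has_sum_sum has_sum_cmult_right has_sum_infsum summable_coth_remainder assms) auto
  also have "(\<lambda>k. \<Sum>j\<le>q. (\<sigma> ^ (q - j) * real (q choose j) * m ^ j) * (of_int k ^ (p + q - j) * coth_remainder s k))
    = (\<lambda>k. of_int k ^ p * (m + \<sigma> * of_int k) ^ q * coth_remainder s k)"
    unfolding binomial_ring sum_distrib_left sum_distrib_right
    by (intro ext sum.cong) (auto simp: power_mult_distrib power_add[symmetric] mult_ac Nat.add_diff_assoc)
  \<comment> \<open>The added terms have \<open>q choose j = 0\<close>; the longer range is that of
    \<open>sum_of_power_products\<close>.\<close>
  also have "(\<Sum>j\<le>q. (\<sigma> ^ (q - j) * real (q choose j) * m ^ j) * remainder_moment s (p + q - j))
    = (\<Sum>j\<le>p + q. \<sigma> ^ (q - j) * real (q choose j) * remainder_moment s (p + q - j) * m ^ j)"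
    by (rule sum.mono_neutral_cong_left) auto
  finally show ?thesis .
qed

text \<open>The signs add up to 2 for 0 < k < M and cancel outside [0, M]. At the two endpoints they
  add up to 1, but there a positive power of 0 makes the summand vanish.\<close>

lemma has_sum_sgn_difference:
  assumes "M > 0" "p > 0" "q > 0"
  shows "((\<lambda>k. of_int k ^ p * (of_int (int M) - of_int k) ^ q * of_int (sgn k + sgn (int M - k))) has_sum
    2 * (\<Sum>k\<le>M. real k ^ p * real (M - k) ^ q)) UNIV"
proof (rule has_sum_finite_neutralI[of "int ` {..M}"])
  have nonneg: "k < 0 \<or> k > int M" if "k \<notin> int ` {..M}" for k
    using that by (cases k rule: int_cases2) (auto simp: image_iff)
  show "of_int k ^ p * (of_int (int M) - of_int k) ^ q * of_int (sgn k + sgn (int M - k)) = (0::real)"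
    if "k \<in> UNIV - int ` {..M}" for k
    using nonneg[of k] that by auto
  show "2 * (\<Sum>k\<le>M. real k ^ p * real (M - k) ^ q)
      = (\<Sum>k\<in>int ` {..M}. of_int k ^ p * (of_int (int M) - of_int k) ^ q * of_int (sgn k + sgn (int M - k)))"
    unfolding sum.reindex[OF inj_on_of_nat] sum_distrib_left
  proof (rule sum.cong)
    fix k assume "k \<in> {..M}"
    then consider "k = 0" | "k = M" | "0 < k" "k < M" by fastforce
    then show "2 * (real k ^ p * real (M - k) ^ q) = ((\<lambda>k. of_int k ^ p * (of_int (int M) - of_int k) ^ q *
      of_int (sgn k + sgn (int M - k))) \<circ> int) k"
      by cases (use assms in \<open>auto simp: of_nat_diff sgn_if\<close>)
  qed simp
qed auto

subsection \<open>Convolution of the Fourier coefficients\<close>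

abbreviation coth_poly :: "real \<Rightarrow> nat \<Rightarrow> nat \<Rightarrow> real \<Rightarrow> real" where
  "coth_poly s \<alpha> \<beta> m \<equiv>
     2 * (fact (1 + \<alpha>) * fact (1 + \<beta>) / fact (3 + \<alpha> + \<beta>)) * m ^ (2 + \<alpha> + \<beta>)
     - (\<Sum>n\<le>\<alpha> + \<beta>. ((-1) ^ (\<beta> + n) * real ((1 + \<beta>) choose (1 + n)) + (-1) ^ (\<alpha> + n) * real ((1 + \<alpha>) choose (1 + n)))
                   * e_coeff s (2 + \<alpha> + \<beta> - n) * m ^ n)"

text \<open>
  The summands at $k = 0$ and $k = m$ of the convolution are not covered by the addition formula for
  $\coth$; they contribute the last two terms.
\<close>

definition conv_poly :: "real \<Rightarrow> nat \<Rightarrow> nat \<Rightarrow> real \<Rightarrow> real" where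
  "conv_poly s \<alpha> \<beta> m =
     coth_poly s \<alpha> \<beta> m
     + s / pi * of_bool (\<alpha> = 0) * m ^ \<beta> + s / pi * of_bool (\<beta> = 0) * m ^ \<alpha>"

lemma e_coeff_odd: "odd l \<Longrightarrow> e_coeff s l = 0"
  by (simp add: e_coeff_def)

text \<open>Three families are added: the signs, the remainders at k, and the remainders at M - k.
  The third is the second with p and q exchanged, by k -> M - k. In each power of M they combine to
  \<open>2 * zneg t + remainder_moment s t\<close>, which is -e_(t+1).\<close>

lemma has_sum_coth_convolution:
  assumes "s > 0" "M > 0"
  defines "w \<equiv> \<lambda>k. of_int (sgn k) + coth_remainder s k"
  shows "((\<lambda>k. of_int k ^ Suc \<alpha> * (real M - of_int k) ^ Suc \<beta> * (w k + w (int M - k))) has_sum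
     real M * coth_poly s \<alpha> \<beta> (real M)) UNIV"
proof -
  define p q where "p = Suc \<alpha>" and "q = Suc \<beta>"
  define c where "c j = (-1) ^ (q + j) * real (q choose j) + (-1) ^ (p + j) * real (p choose j)" for j
  let ?E = "remainder_moment s" and ?m = "real M"
  let ?I = "fact p * fact q / fact (p + q + 1) :: real"
  \<comment> \<open>Natural subtraction truncates for j > a, but then the binomial coefficient is
    0.\<close>
  have sign: "(-1) ^ (a - j) * real (a choose j) = (-1) ^ (a + j) * real (a choose j)" for a j
    by (cases "j \<le> a") (auto simp: minus_one_power_iff)
  have r: "((\<lambda>k. of_int k ^ a * (?m - of_int k) ^ b * coth_remainder s k) has_sum
    (\<Sum>j\<le>a + b. (-1) ^ (b + j) * real (b choose j) * ?E (a + b - j) * ?m ^ j)) UNIV" for a b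
    using has_sum_binomial_coth_remainder[OF assms(1), of a ?m "-1" b] by (simp add: sign)
  have bij: "bij_betw (\<lambda>k. int M - k) UNIV UNIV"
    by (rule bij_betw_byWitness[where f' = "\<lambda>k. int M - k"]) auto
  have "((\<lambda>k. of_int k ^ p * (?m - of_int k) ^ q * coth_remainder s (int M - k)) has_sum
    (\<Sum>j\<le>p + q. (-1) ^ (p + j) * real (p choose j) * ?E (p + q - j) * ?m ^ j)) UNIV"
    using r[of q p] unfolding has_sum_reindex_bij_betw[OF bij, of "\<lambda>k. of_int k ^ q * (?m - of_int k) ^ p * coth_remainder s k", symmetric]
    by (simp add: mult_ac add.commute)
  from has_sum_add[OF has_sum_add[OF has_sum_sgn_difference[OF assms(2), of p q] r[of p q]] this]
  have "((\<lambda>k. of_int k ^ p * (?m - of_int k) ^ q * (w k + w (int M - k))) has_sum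
      (2 * (\<Sum>k\<le>M. real k ^ p * real (M - k) ^ q)
       + (\<Sum>j\<le>p + q. (-1) ^ (q + j) * real (q choose j) * ?E (p + q - j) * ?m ^ j)
       + (\<Sum>j\<le>p + q. (-1) ^ (p + j) * real (p choose j) * ?E (p + q - j) * ?m ^ j))) UNIV"
    by (simp add: w_def p_def q_def algebra_simps del: power_Suc)
  also have "2 * (\<Sum>k\<le>M. real k ^ p * real (M - k) ^ q)
       + (\<Sum>j\<le>p + q. (-1) ^ (q + j) * real (q choose j) * ?E (p + q - j) * ?m ^ j)
       + (\<Sum>j\<le>p + q. (-1) ^ (p + j) * real (p choose j) * ?E (p + q - j) * ?m ^ j)
     = 2 * ?I * ?m ^ (p + q + 1)
       + (\<Sum>j\<le>p + q. c j * (2 * zneg (p + q - j) + ?E (p + q - j)) * ?m ^ j)"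
    unfolding sum_of_power_products
    by (simp add: c_def distrib_left distrib_right sum.distrib sum_distrib_left mult_ac)
  also have "(\<Sum>j\<le>p + q. c j * (2 * zneg (p + q - j) + ?E (p + q - j)) * ?m ^ j)
     = (\<Sum>j\<le>p + q. - c j * e_coeff s (Suc (p + q) - j) * ?m ^ j)"
  proof (rule sum.cong[OF refl])
    fix j assume "j \<in> {..p + q}"
    show "c j * (2 * zneg (p + q - j) + ?E (p + q - j)) * ?m ^ j = - c j * e_coeff s (Suc (p + q) - j) * ?m ^ j"
    proof (cases "j = p + q")
      case True
      \<comment> \<open>This is the index t = 0 excluded from \<open>e_coeff_Suc\<close>; both
        binomials vanish because p and q are positive.\<close>
      then have "c j = 0" by (simp add: c_def p_def q_def binomial_eq_0 del: binomial_Suc_Suc)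
      then show ?thesis by simp
    next
      case False
      then have "Suc (p + q) - j = Suc (p + q - j)" "p + q - j \<ge> 1"
        using \<open>j \<in> {..p + q}\<close> by auto
      then show ?thesis using e_coeff_Suc[OF assms(1)] by simp (simp add: algebra_simps)
    qed
  qed
  also have "\<dots> = (\<Sum>n\<le>\<alpha> + \<beta>. - c (Suc n) * e_coeff s (2 + \<alpha> + \<beta> - n) * ?m ^ Suc n)"
  proof -
    \<comment> \<open>No constant term, hence divisibility by M: c 0 = (-1)^q + (-1)^p vanishes when
      p + q is odd, and otherwise the index p + q + 1 is odd and e vanishes.\<close>
    have "c 0 * e_coeff s (Suc (p + q)) = 0"
      by (cases "even (p + q)") (auto simp: c_def e_coeff_odd minus_one_power_iff)
    moreover have "c (Suc (Suc (\<alpha> + \<beta>))) = 0"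
      by (simp add: c_def p_def q_def binomial_eq_0 del: binomial_Suc_Suc)
    moreover have "p + q = Suc (Suc (\<alpha> + \<beta>))"
      by (simp add: p_def q_def)
    ultimately show ?thesis
      by (simp add: sum.atMost_Suc_shift[of _ "Suc (\<alpha> + \<beta>)"] del: sum.atMost_Suc)
         (simp add: sum.atMost_Suc)
  qed
  also have "\<dots> = - (?m * (\<Sum>n\<le>\<alpha> + \<beta>. ((-1) ^ (\<beta> + n) * real ((1 + \<beta>) choose (1 + n)) + (-1) ^ (\<alpha> + n) * real ((1 + \<alpha>) choose (1 + n)))
                   * e_coeff s (2 + \<alpha> + \<beta> - n) * ?m ^ n))"
  proof -
    have "c (Suc n) = (-1) ^ (\<beta> + n) * real ((1 + \<beta>) choose (1 + n)) + (-1) ^ (\<alpha> + n) * real ((1 + \<alpha>) choose (1 + n))" for n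
      by (simp add: c_def p_def q_def del: binomial_Suc_Suc)
    then show ?thesis
      by (simp only: sum_distrib_left sum_negf[symmetric] power_Suc mult_minus_left mult_minus_right mult_ac)
  qed
  also have "2 * ?I * ?m ^ (p + q + 1) = ?m * (2 * (fact (1 + \<alpha>) * fact (1 + \<beta>) / fact (3 + \<alpha> + \<beta>)) * ?m ^ (2 + \<alpha> + \<beta>))"
    by (simp add: p_def q_def eval_nat_numeral del: fact_Suc)
  finally show ?thesis
    by (simp only: p_def q_def right_diff_distrib add_uminus_conv_diff)
qed

lemma has_sum_u_coeff_convolution:
  assumes "s > 0" "M > 0"
  shows "((\<lambda>k. of_int k ^ \<alpha> * (real M - of_int k) ^ \<beta> * (u_coeff s k * u_coeff s (int M - k))) has_sum
     u_coeff s (int M) * conv_poly s \<alpha> \<beta> (real M)) UNIV"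
proof -
  define w where "w k = of_int (sgn k) + coth_remainder s k" for k
  define S where "S = sinh (real M * pi / s)"
  have S: "S \<noteq> 0" "u_coeff s (int M) = real M / S"
    using assms by (simp_all add: S_def u_coeff_def)
  let ?P = "\<lambda>k. of_int k ^ Suc \<alpha> * (real M - of_int k) ^ Suc \<beta> * (w k + w (int M - k))"
  let ?Q = "coth_poly s \<alpha> \<beta> (real M)"
  \<comment> \<open>At k = 0 and k = M the summand \<open>?P k\<close> is 0, while the true summand
    contains the limit value s/pi of \<open>u_coeff s 0\<close>; \<open>d\<close> restores it, with
    \<open>of_bool\<close> for the power 0^a.\<close>
  define d where "d a b = s / pi * of_bool (a = (0 :: nat)) * real M ^ b * u_coeff s (int M)" for a b
  have single: "((\<lambda>k. if k = k0 then y else 0) has_sum y) UNIV" for k0 :: int and y :: real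
    by (rule has_sum_finite_neutralI[of "{k0}"]) auto
  have "((\<lambda>k. 1 / S * ?P k + (if k = 0 then d \<alpha> \<beta> else 0) + (if k = int M then d \<beta> \<alpha> else 0)) has_sum
     1 / S * (real M * ?Q) + d \<alpha> \<beta> + d \<beta> \<alpha>) UNIV"
    using has_sum_coth_convolution[OF assms] unfolding w_def
    by (intro has_sum_add has_sum_cmult_right single)
  also have "1 / S * (real M * ?Q) + d \<alpha> \<beta> + d \<beta> \<alpha> = u_coeff s (int M) * conv_poly s \<alpha> \<beta> (real M)"
    by (simp add: S conv_poly_def d_def algebra_simps del: fact_Suc)
  also have "(\<lambda>k. 1 / S * ?P k + (if k = 0 then d \<alpha> \<beta> else 0) + (if k = int M then d \<beta> \<alpha> else 0))
    = (\<lambda>k. of_int k ^ \<alpha> * (real M - of_int k) ^ \<beta> * (u_coeff s k * u_coeff s (int M - k)))"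
  proof
    fix k
    show "1 / S * ?P k + (if k = 0 then d \<alpha> \<beta> else 0) + (if k = int M then d \<beta> \<alpha> else 0)
      = of_int k ^ \<alpha> * (real M - of_int k) ^ \<beta> * (u_coeff s k * u_coeff s (int M - k))"
    proof (cases "k = 0 \<or> k = int M")
      case True
      then show ?thesis
        using assms(2) by (auto simp: d_def u_coeff_def power_0_left mult_ac)
    next
      case False
      define A B where "A = of_int k * pi / s" and "B = of_int (int M - k) * pi / s"
      have nz: "sinh A \<noteq> 0" "sinh B \<noteq> 0"
        using False assms by (auto simp: A_def B_def)
      have "w k + w (int M - k) = cosh A / sinh A + cosh B / sinh B"
        using False coth_eq_sgn_plus_remainder[OF assms(1), of k]
          coth_eq_sgn_plus_remainder[OF assms(1), of "int M - k"]
        by (simp add: w_def A_def B_def)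
      also have "\<dots> = sinh (A + B) / (sinh A * sinh B)"
        using nz by (simp add: sinh_add field_simps)
      also have "A + B = real M * pi / s"
        using assms by (simp add: A_def B_def field_simps)
      finally have "w k + w (int M - k) = S / (sinh A * sinh B)"
        by (simp add: S_def)
      moreover have "u_coeff s k = of_int k / sinh A" "u_coeff s (int M - k) = (real M - of_int k) / sinh B"
        using False by (auto simp: u_coeff_def A_def B_def)
      ultimately show ?thesis
        using False S(1) by simp
    qed
  qed
  finally show ?thesis .
qed

text \<open>Monomials of the wrong parity carry an odd-index e, which is 0, and m^\<beta> or
  m^\<alpha> in the extra terms occurs only when the other exponent is 0. This transfers the
  convolution formula from m > 0 to m < 0.\<close>

lemma conv_poly_minus: "conv_poly s \<alpha> \<beta> (- m) = (-1) ^ (\<alpha> + \<beta>) * conv_poly s \<alpha> \<beta> m"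
proof -
  have "e_coeff s (2 + \<alpha> + \<beta> - n) * (- m) ^ n = (-1) ^ (\<alpha> + \<beta>) * (e_coeff s (2 + \<alpha> + \<beta> - n) * m ^ n)"
    if "n \<le> \<alpha> + \<beta>" for n
  proof (cases "even (\<alpha> + \<beta> + n)")
    case True
    then show ?thesis by (subst power_minus) (auto simp: minus_one_power_iff)
  next
    case False
    then have "odd (2 + \<alpha> + \<beta> - n)" using that by auto
    then show ?thesis by (simp add: e_coeff_odd)
  qed
  then have *: "(\<Sum>n\<le>\<alpha> + \<beta>. h n * e_coeff s (2 + \<alpha> + \<beta> - n) * (- m) ^ n)
     = (-1) ^ (\<alpha> + \<beta>) * (\<Sum>n\<le>\<alpha> + \<beta>. h n * e_coeff s (2 + \<alpha> + \<beta> - n) * m ^ n)" for h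
    unfolding sum_distrib_left by (intro sum.cong) (auto simp: mult.assoc mult.left_commute[of _ "h _"])
  have "c * (- m) ^ (2 + \<alpha> + \<beta>) = (-1) ^ (\<alpha> + \<beta>) * (c * m ^ (2 + \<alpha> + \<beta>))" for c
    by (subst power_minus) (simp add: power_add)
  moreover have "c * of_bool (\<alpha> = 0) * (- m) ^ \<beta> = (-1) ^ (\<alpha> + \<beta>) * (c * of_bool (\<alpha> = 0) * m ^ \<beta>)" for c
    by (subst power_minus) auto
  moreover have "c * of_bool (\<beta> = 0) * (- m) ^ \<alpha> = (-1) ^ (\<alpha> + \<beta>) * (c * of_bool (\<beta> = 0) * m ^ \<alpha>)" for c
    by (subst power_minus) auto
  ultimately show ?thesis
    unfolding conv_poly_def * by (simp only: right_diff_distrib distrib_left)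
qed

lemma infsum_u_coeff_convolution:
  assumes "s > 0" "m \<noteq> 0"
  shows "(\<Sum>\<^sub>\<infinity>k. of_int k ^ \<alpha> * of_int (m - k) ^ \<beta> * (u_coeff s k * u_coeff s (m - k)))
     = u_coeff s m * conv_poly s \<alpha> \<beta> (of_int m)"
proof -
  have pos: "(\<Sum>\<^sub>\<infinity>k. of_int k ^ \<alpha> * of_int (m - k) ^ \<beta> * (u_coeff s k * u_coeff s (m - k)))
     = u_coeff s m * conv_poly s \<alpha> \<beta> (of_int m)" if "m > 0" for m
    using has_sum_u_coeff_convolution[OF assms(1), of "nat m" \<alpha> \<beta>] that
    by (auto intro!: infsumI)
  show ?thesis
  proof (cases "m > 0")
    case False
    have "(\<Sum>\<^sub>\<infinity>k. of_int k ^ \<alpha> * of_int (m - k) ^ \<beta> * (u_coeff s k * u_coeff s (m - k)))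
      = (\<Sum>\<^sub>\<infinity>k. (-1) ^ (\<alpha> + \<beta>) * (of_int k ^ \<alpha> * of_int (- m - k) ^ \<beta> * (u_coeff s k * u_coeff s (- m - k))))"
    proof (rule infsum_reindex_bij_witness[of _ uminus uminus])
      fix k :: int
      have "u_coeff s (- m + k) = u_coeff s (m - k)"
        by (metis minus_diff_eq u_coeff_minus uminus_add_conv_diff)
      moreover have "(- of_int k) ^ \<alpha> = (-1) ^ \<alpha> * (of_int k :: real) ^ \<alpha>"
        by (rule power_minus)
      moreover have "(- of_int m + of_int k) ^ \<beta> = (-1) ^ \<beta> * (of_int m - of_int k :: real) ^ \<beta>"
        using power_minus[of "of_int m - of_int k :: real" \<beta>] by simp
      ultimately show "(-1) ^ (\<alpha> + \<beta>) * (of_int (- k) ^ \<alpha> * of_int (- m - - k) ^ \<beta> * (u_coeff s (- k) * u_coeff s (- m - - k)))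
        = of_int k ^ \<alpha> * of_int (m - k) ^ \<beta> * (u_coeff s k * u_coeff s (m - k))"
        by (simp add: power_add) (simp add: minus_one_power_iff)
    qed auto
    also have "\<dots> = (-1) ^ (\<alpha> + \<beta>) * (u_coeff s (- m) * conv_poly s \<alpha> \<beta> (of_int (- m)))"
      by (subst infsum_cmult_right', subst pos) (use False assms in auto)
    finally show ?thesis
      by (simp add: conv_poly_minus)
  qed (rule pos)
qed

section \<open>Signs, and matching with the stated coefficients\<close>

lemma minus_one_powi_diff: "(-1 :: real) powi (int a - int b) = (-1) ^ (a + b)"
  by (simp add: power_int_diff minus_one_power_iff)

text \<open>The n-th derivative multiplies the coefficient at m by (-i m)^n, so the left side is the
  symbol of the differential operator on the right of the theorem. The factor
  (-i)^(\<alpha>+\<beta>) comes from the two derivatives in the product.\<close>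

lemma b_coeff_sum_eq:
  "(\<Sum>n = 0..2 + \<alpha> + \<beta>. of_real (b_coeff s \<alpha> \<beta> n) * (- \<i> * of_real m) ^ n)
     = (- \<i>) ^ (\<alpha> + \<beta>) * of_real (conv_poly s \<alpha> \<beta> m)"
proof -
  let ?c = "\<lambda>n. (-1) ^ (\<beta> + n) * real ((1 + \<beta>) choose (1 + n)) + (-1) ^ (\<alpha> + n) * real ((1 + \<alpha>) choose (1 + n))"
  let ?e = "\<lambda>n. e_coeff s (2 + \<alpha> + \<beta> - n)"
  let ?z = "- \<i> * of_real m"
  have summand: "of_real (b_coeff s \<alpha> \<beta> n) * ?z ^ n
     = (- \<i>) ^ (\<alpha> + \<beta>) * of_real (- (?c n * ?e n * m ^ n))
       + (if n = \<alpha> then of_real (s / pi * of_bool (\<beta> = 0)) * ?z ^ n else 0)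
       + (if n = \<beta> then of_real (s / pi * of_bool (\<alpha> = 0)) * ?z ^ n else 0)" if "n \<le> \<alpha> + \<beta>" for n
  proof -
    define B where "B = (-1 :: real) powi (1 + (int \<beta> - int \<alpha> + int n) div 2)
             * (real ((1 + \<alpha>) choose (1 + n)) + (- 1) ^ n * real ((1 + \<beta>) choose (1 + n)))"
    have "of_real (B * ?e n) * (- \<i>) ^ n = (- \<i>) ^ (\<alpha> + \<beta>) * of_real (- ?c n * ?e n)"
    proof (cases "even (\<alpha> + \<beta> + n)")
      case True
      then have "even (\<alpha> + \<beta> - n)" using that by auto
      then obtain d where "\<alpha> + \<beta> - n = 2 * d" by blast
      then have d: "\<alpha> + \<beta> = n + 2 * d" using that by simp
      \<comment> \<open>The numerator equals 2 (\<beta> - d), so \<open>div\<close> is exact. The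
        resulting sign (-1)^(1+\<beta>+d) matches because (-i)^(\<alpha>+\<beta>) = (-i)^n
        (-1)^d.\<close>
      then have "(int \<beta> - int \<alpha> + int n) div 2 = int \<beta> - int d" by linarith
      then have "(-1 :: real) powi (1 + (int \<beta> - int \<alpha> + int n) div 2) = (-1) ^ (Suc \<beta> + d)"
        using minus_one_powi_diff[of "Suc \<beta>" d] by (simp add: add_diff_eq)
      moreover have "(-1 :: real) ^ (\<alpha> + n) = (-1) ^ \<beta>"
        using True by (auto simp: minus_one_power_iff)
      ultimately have "B = (-1) ^ d * - ?c n"
        unfolding B_def by (simp add: power_add algebra_simps del: binomial_Suc_Suc)
      moreover have "(- \<i>) ^ (\<alpha> + \<beta>) = (- \<i>) ^ n * (-1) ^ d"
        unfolding d by (simp add: power_add power_mult)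
      ultimately show ?thesis
        by (simp del: binomial_Suc_Suc)
    next
      case False
      then have "odd (2 + \<alpha> + \<beta> - n)" using that by auto
      then show ?thesis by (simp add: e_coeff_odd)
    qed
    then have 1: "of_real (B * ?e n) * ?z ^ n = (- \<i>) ^ (\<alpha> + \<beta>) * of_real (- ?c n * ?e n * m ^ n)"
      unfolding of_real_mult[of _ "m ^ n"] mult.assoc[symmetric] power_mult_distrib of_real_power by simp
    have 1: "of_real (B * ?e n) * ?z ^ n = (- \<i>) ^ (\<alpha> + \<beta>) * of_real (- (?c n * ?e n * m ^ n))"
      using 1 by (simp only: mult_minus_left)
    have "b_coeff s \<alpha> \<beta> n = B * ?e n + (if n = \<alpha> then s / pi * of_bool (\<beta> = 0) else 0)
       + (if n = \<beta> then s / pi * of_bool (\<alpha> = 0) else 0)"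
      using that by (auto simp: b_coeff_def B_def simp del: binomial_Suc_Suc)
    then show ?thesis
      by (simp only: of_real_add distrib_right 1) (simp del: binomial_Suc_Suc)
  qed
  have "{0..2 + \<alpha> + \<beta>} = insert (2 + \<alpha> + \<beta>) (insert (1 + \<alpha> + \<beta>) {..\<alpha> + \<beta>})"
    by auto
  then have "(\<Sum>n = 0..2 + \<alpha> + \<beta>. of_real (b_coeff s \<alpha> \<beta> n) * ?z ^ n)
    = of_real (b_coeff s \<alpha> \<beta> (2 + \<alpha> + \<beta>)) * ?z ^ (2 + \<alpha> + \<beta>)
      + (\<Sum>n\<le>\<alpha> + \<beta>. of_real (b_coeff s \<alpha> \<beta> n) * ?z ^ n)"
    by (simp add: b_coeff_def[of _ _ _ "Suc (\<alpha> + \<beta>)"])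
  \<comment> \<open>The surplus factor (-i)^2 = -1 cancels the minus sign of the leading
    coefficient.\<close>
  also have "of_real (b_coeff s \<alpha> \<beta> (2 + \<alpha> + \<beta>)) * ?z ^ (2 + \<alpha> + \<beta>)
    = (- \<i>) ^ (\<alpha> + \<beta>) * of_real (2 * (fact (1 + \<alpha>) * fact (1 + \<beta>) / fact (3 + \<alpha> + \<beta>)) * m ^ (2 + \<alpha> + \<beta>))"
    unfolding power_mult_distrib by (simp add: b_coeff_def power_add del: fact_Suc)
  also have "(\<Sum>n\<le>\<alpha> + \<beta>. of_real (b_coeff s \<alpha> \<beta> n) * ?z ^ n)
    = (- \<i>) ^ (\<alpha> + \<beta>) * of_real (- (\<Sum>n\<le>\<alpha> + \<beta>. ?c n * ?e n * m ^ n))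
       + of_real (s / pi * of_bool (\<beta> = 0)) * ?z ^ \<alpha> + of_real (s / pi * of_bool (\<alpha> = 0)) * ?z ^ \<beta>"
  proof -
    have "(\<Sum>n\<le>\<alpha> + \<beta>. of_real (b_coeff s \<alpha> \<beta> n) * ?z ^ n)
      = (\<Sum>n\<le>\<alpha> + \<beta>. (- \<i>) ^ (\<alpha> + \<beta>) * of_real (- (?c n * ?e n * m ^ n))
       + (if n = \<alpha> then of_real (s / pi * of_bool (\<beta> = 0)) * ?z ^ n else 0)
       + (if n = \<beta> then of_real (s / pi * of_bool (\<alpha> = 0)) * ?z ^ n else 0))"
      by (rule sum.cong[OF refl], rule summand) simp
    also have "\<dots> = (- \<i>) ^ (\<alpha> + \<beta>) * of_real (- (\<Sum>n\<le>\<alpha> + \<beta>. ?c n * ?e n * m ^ n))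
       + (\<Sum>n\<le>\<alpha> + \<beta>. if n = \<alpha> then of_real (s / pi * of_bool (\<beta> = 0)) * ?z ^ n else 0)
       + (\<Sum>n\<le>\<alpha> + \<beta>. if n = \<beta> then of_real (s / pi * of_bool (\<alpha> = 0)) * ?z ^ n else 0)"
      by (simp only: sum.distrib sum_distrib_left[symmetric] of_real_sum[symmetric] sum_negf)
    finally show ?thesis
      by (simp only: sum.delta finite_atMost) simp
  qed
  also have "of_real (s / pi * of_bool (\<beta> = 0)) * ?z ^ \<alpha>
    = (- \<i>) ^ (\<alpha> + \<beta>) * of_real (s / pi * of_bool (\<beta> = 0) * m ^ \<alpha>)"
    unfolding power_mult_distrib by auto
  also have "of_real (s / pi * of_bool (\<alpha> = 0)) * ?z ^ \<beta>
    = (- \<i>) ^ (\<alpha> + \<beta>) * of_real (s / pi * of_bool (\<alpha> = 0) * m ^ \<beta>)"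
    unfolding power_mult_distrib by auto
  finally show ?thesis
    unfolding conv_poly_def
    by (simp only: distrib_left[symmetric] of_real_add[symmetric]) (simp only: add_ac diff_conv_add_uminus)
qed

lemma F_sum_odd: "odd m \<Longrightarrow> F_sum s m = 0"
proof -
  assume "odd m"
  let ?h = "\<lambda>k :: int. if k = 0 then (if m = 0 then s\<^sup>2 / pi\<^sup>2 else 0)
     else of_int k ^ (2 + m) / (sinh (of_int k * pi / s))\<^sup>2"
  have "infsum ?h UNIV = (\<Sum>\<^sub>\<infinity>k. - ?h k)"
    by (rule infsum_reindex_bij_witness[of _ uminus uminus])
       (use \<open>odd m\<close> in \<open>auto simp: power_minus_odd\<close>)
  also have "\<dots> = - infsum ?h UNIV" by (rule infsum_uminus)
  finally show ?thesis by (simp add: F_sum_def)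
qed

text \<open>At m = 0 the addition formula degenerates, since sinh(A + B) = 0, but the product is
  directly of the form k^2/sinh^2 times powers of k. The term with b(0) is there because the summand
  n = 0 of the theorem contributes b(0) s/pi to this coefficient, and \<open>c_coeff\<close>
  subtracts it.\<close>

lemma zeroth_coefficient:
  "(- \<i>) ^ (\<alpha> + \<beta>) * of_real (\<Sum>\<^sub>\<infinity>k. of_int k ^ \<alpha> * of_int (- k) ^ \<beta> * (u_coeff s k * u_coeff s (- k)))
     = of_real (c_coeff s \<alpha> \<beta> + s / pi * b_coeff s \<alpha> \<beta> 0)"
proof -
  have "(\<Sum>\<^sub>\<infinity>k. of_int k ^ \<alpha> * of_int (- k) ^ \<beta> * (u_coeff s k * u_coeff s (- k)))
      = (\<Sum>\<^sub>\<infinity>k. (-1) ^ \<beta> * (if k = 0 then (if \<alpha> + \<beta> = 0 then s\<^sup>2 / pi\<^sup>2 else 0)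
     else of_int k ^ (2 + (\<alpha> + \<beta>)) / (sinh (of_int k * pi / s))\<^sup>2))"
  proof (rule infsum_cong)
    fix k :: int
    have "(of_int (- k) :: real) ^ \<beta> = (-1) ^ \<beta> * of_int k ^ \<beta>"
      using power_minus[of "of_int k :: real" \<beta>] by simp
    then show "of_int k ^ \<alpha> * of_int (- k) ^ \<beta> * (u_coeff s k * u_coeff s (- k))
      = (-1) ^ \<beta> * (if k = 0 then (if \<alpha> + \<beta> = 0 then s\<^sup>2 / pi\<^sup>2 else 0)
     else of_int k ^ (2 + (\<alpha> + \<beta>)) / (sinh (of_int k * pi / s))\<^sup>2)"
      by (auto simp: u_coeff_def power_add power2_eq_square power_0_left)
  qed
  also have "\<dots> = (-1) ^ \<beta> * F_sum s (\<alpha> + \<beta>)"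
    unfolding F_sum_def by (rule infsum_cmult_right')
  finally have *: "(\<Sum>\<^sub>\<infinity>k. of_int k ^ \<alpha> * of_int (- k) ^ \<beta> * (u_coeff s k * u_coeff s (- k)))
      = (-1) ^ \<beta> * F_sum s (\<alpha> + \<beta>)" .
  show ?thesis
  proof (cases "even (\<alpha> + \<beta>)")
    case True
    then obtain d where d: "\<alpha> + \<beta> = 2 * d" by blast
    then have "(int \<alpha> - int \<beta>) div 2 = int d - int \<beta>" by linarith
    then have "(-1 :: real) powi ((int \<alpha> - int \<beta>) div 2) = (-1) ^ (d + \<beta>)"
      using minus_one_powi_diff by simp
    moreover have "(- \<i>) ^ (\<alpha> + \<beta>) = (-1) ^ d"
      unfolding d by (simp add: power_mult)
    ultimately show ?thesis
      unfolding * c_coeff_def by (simp add: power_add)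
  next
    case False
    then show ?thesis
      unfolding * c_coeff_def by (simp add: F_sum_odd)
  qed
qed

theorem theorem2p3:
  fixes \<alpha> \<beta> :: nat and s x :: real
  assumes "s > 0"
  shows "nth_derivative \<alpha> (u s) x * nth_derivative \<beta> (u s) x =
    (\<Sum>n = 0..2 + \<alpha> + \<beta>. of_real (b_coeff s \<alpha> \<beta> n) * nth_derivative n (u s) x)
      + of_real (c_coeff s \<alpha> \<beta>)"
proof -
  define E where "E k = exp (- \<i> * of_int k * of_real x)" for k :: int
  define f where "f n k = (- \<i> * of_int k) ^ n * of_real (u_coeff s k) * E k" for n and k :: int
  have deriv: "nth_derivative n (u s) x = infsum (f n) UNIV" for n
    unfolding nth_derivative_u[OF assms] f_def E_def ..
  have "norm (E k) = 1" for k
    by (simp add: E_def norm_exp_eq_Re)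
  then have abs: "(\<lambda>k. norm (f n k)) summable_on UNIV" for n
    using summable_norm_u_coeff[OF assms, of n] by (simp add: f_def norm_mult)
  have E_add: "E k * E (m - k) = E m" for k m
    by (simp add: E_def exp_add[symmetric] algebra_simps)
  \<comment> \<open>The terms of frequency m on both sides, exponentials included; the constant
    enters at m = 0 only. Summing over m then gives the claim.\<close>
  have coeff: "(\<Sum>\<^sub>\<infinity>k. f \<alpha> k * f \<beta> (m - k))
      = (\<Sum>n = 0..2 + \<alpha> + \<beta>. of_real (b_coeff s \<alpha> \<beta> n) * f n m) + (if m = 0 then of_real (c_coeff s \<alpha> \<beta>) else 0)" for m
  proof -
    let ?a = "\<lambda>k. of_int k ^ \<alpha> * of_int (m - k) ^ \<beta> * (u_coeff s k * u_coeff s (m - k))"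
    have "f \<alpha> k * f \<beta> (m - k) = ((- \<i>) ^ (\<alpha> + \<beta>) * E m) * of_real (?a k)" for k
      unfolding f_def E_add[of k m, symmetric] power_mult_distrib power_add by simp
    then have conv: "(\<Sum>\<^sub>\<infinity>k. f \<alpha> k * f \<beta> (m - k)) = (- \<i>) ^ (\<alpha> + \<beta>) * E m * of_real (\<Sum>\<^sub>\<infinity>k. ?a k)"
      by (simp only: infsum_cmult_right' infsum_of_real_complex)
    show ?thesis
    proof (cases "m = 0")
      case True
      \<comment> \<open>At frequency 0 all proper derivatives vanish, as \<open>0 ^ n = 0\<close>
        for n > 0.\<close>
      have "(\<Sum>n = 0..2 + \<alpha> + \<beta>. of_real (b_coeff s \<alpha> \<beta> n) * f n 0) = (\<Sum>n \<in> {0}. of_real (b_coeff s \<alpha> \<beta> n) * f n 0)"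
        by (rule sum.mono_neutral_right) (auto simp: f_def)
      then show ?thesis
        unfolding conv using zeroth_coefficient[of \<alpha> \<beta> s] True
        by (simp add: f_def E_def u_coeff_def)
    next
      case False
      have f_m: "f n m = (- \<i> * of_real (of_int m)) ^ n * (of_real (u_coeff s m) * E m)" for n
        by (simp add: f_def)
      show ?thesis using False
        unfolding conv infsum_u_coeff_convolution[OF assms False] f_m
        unfolding mult.assoc[symmetric] sum_distrib_right[symmetric] b_coeff_sum_eq
        by simp
    qed
  qed
  have "((\<lambda>m. (\<Sum>n = 0..2 + \<alpha> + \<beta>. of_real (b_coeff s \<alpha> \<beta> n) * f n m) + (if m = 0 then of_real (c_coeff s \<alpha> \<beta>) else 0))
     has_sum (\<Sum>n = 0..2 + \<alpha> + \<beta>. of_real (b_coeff s \<alpha> \<beta> n) * nth_derivative n (u s) x) + of_real (c_coeff s \<alpha> \<beta>)) UNIV"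
    unfolding deriv
  proof (intro has_sum_add has_sum_sum has_sum_cmult_right has_sum_infsum)
    show "f n summable_on UNIV" for n
      using abs by (rule abs_summable_summable)
    show "((\<lambda>m :: int. if m = 0 then of_real (c_coeff s \<alpha> \<beta>) else 0) has_sum (of_real (c_coeff s \<alpha> \<beta>) :: complex)) UNIV"
      by (rule has_sum_finite_neutralI[of "{0}"]) auto
  qed auto
  then show ?thesis
    unfolding deriv infsum_mult_convolution[OF abs abs] coeff by (rule infsumI)
qed

end
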